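(* Let $p_1,p_2,p_3,\ldots$ be numbers, and for each $n\geq 1$ let $P_n$ be the $n\times n$ matrix $$P_n= \left[\begin{array}{rrrrrr} p_{1}&p_{2}&p_{3}&\cdots&p_{n-1}&p_{n}\\ -1&p_{1}&p_{2}&\cdots&p_{n-2}&p_{n-1}\\ 0&-1&p_{1}&\cdots&p_{n-3}&p_{n-2}\\ \vdots&\vdots&\vdots&\ddots&\vdots&\vdots\\ 0&0&0&\cdots&p_{1}&p_{2}\\ 0&0&0&\cdots&-1&p_{1}\end{array}\right],$$ that is, the $(i,j)$ entry of $P_n$ is $p_{j-i+1}$ if $j\geq i$, is $-1$ if $i=j+1$, and is $0$ if $i>j+1$. Let the sequence $a_1,a_2,a_3,\ldots$ with $a_1\neq 0$ be defined by $$a_{n+1}=\sum_{i=1}^{n}p_{n-i+1}a_i\qquad (n=1,2,\ldots).$$ Then $$a_{n+1}=a_1\det P_n\qquad (n=1,2,\ldots).$$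
   Context: The paper does not specify the nature of the numbers $p_i$ and $a_1$; they may be taken to be complex numbers. *)

theory Defs
  imports Complex_Main "Jordan_Normal_Form.Determinant"
begin

(* Library matrices have rows and columns numbered from 0; the entries depend only on j - i,
   so the formula is the same as for indices starting at 1. The value p 0 is never used. *)
definition P_mat :: "(nat \<Rightarrow> complex) \<Rightarrow> nat \<Rightarrow> complex mat" where
  "P_mat p n = mat n n (\<lambda>(i, j).
     if i \<le> j then p (j - i + 1) else if i = j + 1 then -1 else 0)"

end

theory Submission
  imports Defs
begin

text \<open>
  Expand \<open>det P\<^sub>n\<close> along the last column. Deleting the last column and row \<open>i\<close> (counted from 0)
  leaves a block upper triangular matrix with diagonal blocks \<open>P\<^sub>i\<close> and an upper triangular
  matrix of size \<open>n - 1 - i\<close> with diagonal entries \<open>-1\<close>. The sign of the second block's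
  determinant cancels the sign of the cofactor, so \<open>det P\<^sub>n\<close> satisfies the recurrence of the sequence.
\<close>

lemma P_mat_carrier: "P_mat p n \<in> carrier_mat n n"
  by (simp add: P_mat_def)

lemma det_upper_triangular_const_diag:
  fixes A :: "'a :: idom mat"
  assumes "A \<in> carrier_mat n n" "upper_triangular A" "\<And>i. i < n \<Longrightarrow> A $$ (i, i) = c"
  shows "det A = c ^ n"
proof -
  have "diag_mat A = replicate n c"
    using assms by (intro nth_equalityI) (auto simp: diag_mat_def)
  then show ?thesis
    using det_upper_triangular[OF assms(2,1)] by simp
qed

lemma det_mat_delete_P_mat:
  assumes "i \<le> m"
  shows "det (mat_delete (P_mat p (Suc m)) i m) = (-1) ^ (m - i) * det (P_mat p i)"
proof -
  define B where "B = mat i (m - i) (\<lambda>(r, c). P_mat p (Suc m) $$ (r, i + c))"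
  \<comment> \<open>Row \<open>i\<close> is deleted, so rows start at \<open>Suc i\<close> but
    columns at \<open>i\<close>: the subdiagonal of \<open>P_mat\<close> becomes the diagonal of
    \<open>D\<close>.\<close>
  define D where "D = mat (m - i) (m - i) (\<lambda>(r, c). P_mat p (Suc m) $$ (Suc i + r, i + c))"
  have B: "B \<in> carrier_mat i (m - i)" and D: "D \<in> carrier_mat (m - i) (m - i)"
    by (simp_all add: B_def D_def)
  \<comment> \<open>The lower left block is zero: its rows have index above \<open>i\<close> and its
    columns index below \<open>i\<close>, so its entries lie below the subdiagonal.\<close>
  have "mat_delete (P_mat p (Suc m)) i m = four_block_mat (P_mat p i) B (0\<^sub>m (m - i) i) D"
    using assms by (intro eq_matI) (auto simp: mat_delete_def P_mat_def B_def D_def)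
  then have "det (mat_delete (P_mat p (Suc m)) i m) = det (P_mat p i) * det D"
    using det_four_block_mat_lower_left_zero[OF P_mat_carrier B refl D] by simp
  moreover have "det D = (-1) ^ (m - i)"
    using D by (intro det_upper_triangular_const_diag) (auto simp: D_def P_mat_def)
  ultimately show ?thesis
    by simp
qed

lemma det_P_mat_Suc:
  "det (P_mat p (Suc m)) = (\<Sum>i\<le>m. p (Suc m - i) * det (P_mat p i))"
proof -
  have cofactor: "cofactor (P_mat p (Suc m)) i m = det (P_mat p i)" if "i \<le> m" for i
  proof -
    have "cofactor (P_mat p (Suc m)) i m = (-1) ^ ((i + m) + (m - i)) * det (P_mat p i)"
      by (simp only: cofactor_def det_mat_delete_P_mat[OF that] power_add mult.assoc)
    \<comment> \<open>The exponent is \<open>2 * m\<close>.\<close>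
    moreover have "even ((i + m) + (m - i))"
      using that by simp
    ultimately show ?thesis
      by simp
  qed
  have entry: "P_mat p (Suc m) $$ (i, m) = p (Suc m - i)" if "i \<le> m" for i
    using that by (simp add: P_mat_def Suc_diff_le)
  have "det (P_mat p (Suc m)) =
      (\<Sum>i<Suc m. P_mat p (Suc m) $$ (i, m) * cofactor (P_mat p (Suc m)) i m)"
    by (intro laplace_expansion_column P_mat_carrier) simp
  also have "\<dots> = (\<Sum>i\<le>m. p (Suc m - i) * det (P_mat p i))"
    unfolding lessThan_Suc_atMost
    by (intro sum.cong refl) (simp add: cofactor entry)
  finally show ?thesis .
qed

theorem theorem1:
  fixes p a :: "nat \<Rightarrow> complex"
  assumes "a 1 \<noteq> 0"
    and "\<And>n. n \<ge> 1 \<Longrightarrow> a (n + 1) = (\<Sum>i = 1..n. p (n - i + 1) * a i)"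
  shows "\<forall>n\<ge>1. a (n + 1) = a 1 * det (P_mat p n)"
proof -
  \<comment> \<open>The case \<open>n = 0\<close> is included, with empty determinant 1, since the
    expansion of \<open>det (P_mat p (Suc m))\<close> involves all smaller sizes down to 0.\<close>
  have "a (n + 1) = a 1 * det (P_mat p n)" for n
  proof (induction n rule: less_induct)
    case (less n)
    show ?case
    proof (cases n)
      case 0
      then show ?thesis
        by (simp add: det_dim_zero[OF P_mat_carrier])
    next
      case (Suc m)
      have "a (n + 1) = (\<Sum>i = Suc 0..Suc m. p (n - i + 1) * a i)"
        using assms(2)[of n] Suc by simp
      \<comment> \<open>Shifting the index by one makes each term \<open>a (i + 1)\<close> an
        instance of the induction hypothesis at \<open>i < n\<close>.\<close>
      also have "\<dots> = (\<Sum>i\<le>m. p (Suc m - i) * a (i + 1))"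
        unfolding sum.shift_bounds_cl_Suc_ivl atMost_atLeast0
        by (intro sum.cong refl) (simp add: Suc Suc_diff_le)
      also have "\<dots> = (\<Sum>i\<le>m. p (Suc m - i) * (a 1 * det (P_mat p i)))"
        by (intro sum.cong refl arg_cong2[where f = times] less.IH) (simp add: Suc)
      also have "\<dots> = a 1 * det (P_mat p n)"
        by (simp add: Suc det_P_mat_Suc sum_distrib_left mult.left_commute)
      finally show ?thesis .
    qed
  qed
  then show ?thesis
    by blast
qed

end
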